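(* Let $\mathfrak{M}(\mathbb{O})=\operatorname{Im}(\mathbb{O})$ be the $7$-dimensional real Malcev algebra of purely imaginary octonions with bracket $[x,y]=\tfrac12(xy-yx)$. For any non-zero $x\in\mathfrak{M}(\mathbb{O})$, the operator $\operatorname{ad}(x)\colon\mathfrak{M}(\mathbb{O})\to\mathfrak{M}(\mathbb{O})$, $y\mapsto[x,y]$, has eigenvalues $$0\ (\text{multiplicity }1),\qquad +i\|x\|\ (\text{multiplicity }3),\qquad -i\|x\|\ (\text{multiplicity }3).$$ In particular, $\operatorname{ad}(x)^3=-\|x\|^2\operatorname{ad}(x)$.
   Context: $\mathbb{O}$ is the algebra of real octonions with the Euclidean inner product $\langle x,y\rangle=\operatorname{Re}(x\bar y)$ and associated norm $\|x\|$. Eigenvalues are those of the complexification of $\operatorname{ad}(x)$, which is diagonalizable over $\mathbb{C}$ since $\operatorname{ad}(x)$ is skew-symmetric. *)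

theory Defs
  imports "HOL-Analysis.Analysis" "Jordan_Normal_Form.Char_Poly"
begin

section \<open>Octonions by Cayley-Dickson doubling\<close>

text \<open>
  Quaternions are pairs of complex numbers and octonions are pairs of quaternions. As iterated
  products of \<^typ>\<open>complex\<close> both types carry the Euclidean structure of \<open>HOL-Analysis\<close>;
  the lemmas \<open>inner_octonion\<close> and \<open>norm_octonion\<close> below identify it with the one
  given by the octonion multiplication. Both doublings use
  $(a,b)(c,d) = (ac - \bar d b,\; da + b \bar c)$ and $\overline{(a,b)} = (\bar a, -b)$.
\<close>

type_synonym quaternion = "complex \<times> complex"
type_synonym octonion = "quaternion \<times> quaternion"

fun qcnj :: "quaternion \<Rightarrow> quaternion" where
  "qcnj (a, b) = (cnj a, - b)"

fun qmult :: "quaternion \<Rightarrow> quaternion \<Rightarrow> quaternion" where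
  "qmult (a, b) (c, d) = (a * c - cnj d * b, d * a + b * cnj c)"

fun ocnj :: "octonion \<Rightarrow> octonion" where
  "ocnj (p, q) = (qcnj p, - q)"

fun omult :: "octonion \<Rightarrow> octonion \<Rightarrow> octonion" (infixl "\<star>" 70) where
  "(p, q) \<star> (r, s) = (qmult p r - qmult (qcnj s) q, qmult s p + qmult q (qcnj r))"

definition oone :: octonion where
  "oone = ((1, 0), (0, 0))"

definition oRe :: "octonion \<Rightarrow> real" where
  "oRe x = Re (fst (fst x))"

definition Im_oct :: "octonion set" where
  "Im_oct = {x. oRe x = 0}"

lemma omult_oone [simp]: "oone \<star> x = x" "x \<star> oone = x"
  by (cases x rule: ocnj.cases; cases "fst x"; cases "snd x"; simp add: oone_def)+

lemma bilinear_omult: "bilinear omult"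
  unfolding bilinear_def
  by (auto intro!: linearI simp: split_paired_all scaleR_conv_of_real algebra_simps)

lemma inner_octonion: "inner x y = oRe (x \<star> ocnj y)"
  by (cases x; cases y; cases "fst x"; cases "snd x"; cases "fst y"; cases "snd y")
     (simp add: oRe_def inner_complex_def)

lemma norm_octonion: "norm x = sqrt (oRe (x \<star> ocnj x))"
  by (simp add: norm_eq_sqrt_inner inner_octonion)

lemma octonion_exhaust: obtains a b c d where "(x :: octonion) = ((a, b), (c, d))"
  by (metis surj_pair)

lemma omult_alternative: "x \<star> (x \<star> y) = (x \<star> x) \<star> y" "(y \<star> x) \<star> x = y \<star> (x \<star> x)"
  by (cases x rule: octonion_exhaust; cases y rule: octonion_exhaust;
      simp add: complex_eq_iff algebra_simps)+

lemma norm_omult: "norm (x \<star> y) = norm x * norm y"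
proof -
  have "inner (x \<star> y) (x \<star> y) = inner x x * inner y y"
    by (cases x rule: octonion_exhaust; cases y rule: octonion_exhaust)
       (simp add: inner_complex_def algebra_simps)
  then show ?thesis
    by (simp add: norm_eq_sqrt_inner real_sqrt_mult)
qed

section \<open>The Malcev algebra of imaginary octonions\<close>

definition obracket :: "octonion \<Rightarrow> octonion \<Rightarrow> octonion" where
  "obracket x y = (1/2) *\<^sub>R (x \<star> y - y \<star> x)"

definition ad :: "octonion \<Rightarrow> octonion \<Rightarrow> octonion" where
  "ad x = (\<lambda>y. obracket x y)"

lemma subspace_Im_oct: "subspace Im_oct"
  by (auto simp: Im_oct_def oRe_def subspace_def)

lemma obracket_in_Im_oct: "obracket x y \<in> Im_oct"
  by (cases x; cases y; cases "fst x"; cases "snd x"; cases "fst y"; cases "snd y")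
     (simp add: Im_oct_def obracket_def oRe_def)

lemma obracket_anticomm: "obracket y x = - obracket x y"
  by (simp add: obracket_def algebra_simps)

definition ojacobian :: "octonion \<Rightarrow> octonion \<Rightarrow> octonion \<Rightarrow> octonion" where
  "ojacobian x y z = obracket (obracket x y) z + obracket (obracket y z) x + obracket (obracket z x) y"

definition oassociator :: "octonion \<Rightarrow> octonion \<Rightarrow> octonion \<Rightarrow> octonion" where
  "oassociator x y z = (x \<star> y) \<star> z - x \<star> (y \<star> z)"

lemma oassociator_alternating:
  "oassociator y x z = - oassociator x y z" "oassociator x z y = - oassociator x y z"
  by (cases x rule: octonion_exhaust; cases y rule: octonion_exhaust; cases z rule: octonion_exhaust,
      simp add: oassociator_def algebra_simps)+

lemma oassociator_mult:
  "oassociator x y (x \<star> z) = oassociator x y z \<star> x"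
  "oassociator x y (z \<star> x) = x \<star> oassociator x y z"
  by (cases x rule: octonion_exhaust; cases y rule: octonion_exhaust; cases z rule: octonion_exhaust,
      simp add: oassociator_def algebra_simps)+

lemmas omult_bilinear_simps =
  bilinear_ladd[OF bilinear_omult] bilinear_radd[OF bilinear_omult]
  bilinear_lsub[OF bilinear_omult] bilinear_rsub[OF bilinear_omult]
  bilinear_lmul[OF bilinear_omult] bilinear_rmul[OF bilinear_omult]

lemma ojacobian_eq_oassociator: "ojacobian x y z = (3/2) *\<^sub>R oassociator x y z"
proof -
  have "4 *\<^sub>R ojacobian x y z =
      oassociator x y z + oassociator y z x + oassociator z x y
      - oassociator y x z - oassociator x z y - oassociator z y x"
    by (simp add: ojacobian_def obracket_def oassociator_def omult_bilinear_simps algebra_simps)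
  also have "\<dots> = 6 *\<^sub>R oassociator x y z"
    using oassociator_alternating[of x y z] oassociator_alternating[of z x y]
      oassociator_alternating[of y z x]
    by (simp add: prod_eq_iff complex_eq_iff)
  finally have "(1/4) *\<^sub>R (4 *\<^sub>R ojacobian x y z) = (1/4) *\<^sub>R (6 *\<^sub>R oassociator x y z)"
    by simp
  then show ?thesis
    by simp
qed

lemma malcev: "ojacobian x y (obracket x z) = obracket (ojacobian x y z) x"
proof -
  have "oassociator x y (obracket x z) =
      (1/2) *\<^sub>R (oassociator x y (x \<star> z) - oassociator x y (z \<star> x))"
    by (simp add: obracket_def oassociator_def omult_bilinear_simps algebra_simps)
  also have "\<dots> = obracket (oassociator x y z) x"
    by (simp add: oassociator_mult obracket_def)
  finally have "oassociator x y (obracket x z) = obracket (oassociator x y z) x" .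
  moreover have "obracket (c *\<^sub>R u) x = c *\<^sub>R obracket u x" for c u
    by (simp add: obracket_def omult_bilinear_simps scaleR_diff_right mult.commute)
  ultimately show ?thesis
    by (simp add: ojacobian_eq_oassociator)
qed

definition imag_units :: "octonion list" where
  "imag_units = [((\<i>, 0), (0, 0)), ((0, 1), (0, 0)), ((0, \<i>), (0, 0)),
     ((0, 0), (1, 0)), ((0, 0), (\<i>, 0)), ((0, 0), (0, 1)), ((0, 0), (0, \<i>))]"

lemma length_imag_units: "length imag_units = 7"
  by (simp add: imag_units_def)

lemma imag_units_orthonormal:
  "i < 7 \<Longrightarrow> j < 7 \<Longrightarrow> inner (imag_units ! i) (imag_units ! j) = (if i = j then 1 else 0)"
  by (auto simp: imag_units_def inner_complex_def less_Suc_eq numeral_eq_Suc)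

lemma imag_units_expansion:
  assumes "x \<in> Im_oct"
  shows "x = (\<Sum>i<7. inner x (imag_units ! i) *\<^sub>R imag_units ! i)"
  using assms
  by (cases x rule: octonion_exhaust)
     (simp add: imag_units_def Im_oct_def oRe_def inner_complex_def numeral_eq_Suc complex_eq_iff zero_prod_def)

lemma span_imag_units: "span (set imag_units) = Im_oct"
proof
  show "span (set imag_units) \<subseteq> Im_oct"
    by (rule span_minimal[OF _ subspace_Im_oct]) (auto simp: imag_units_def Im_oct_def oRe_def)
  show "Im_oct \<subseteq> span (set imag_units)"
  proof
    fix x assume "x \<in> Im_oct"
    then have "x = (\<Sum>i<7. inner x (imag_units ! i) *\<^sub>R imag_units ! i)"
      by (rule imag_units_expansion)
    moreover have "\<dots> \<in> span (set imag_units)"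
      by (intro span_sum span_scale span_base) (simp add: length_imag_units)
    ultimately show "x \<in> span (set imag_units)"
      by metis
  qed
qed

lemma dim_Im_oct: "dim Im_oct = 7"
proof -
  have "pairwise Linear_Algebra.orthogonal (set imag_units)" "0 \<notin> set imag_units"
    by (auto simp: imag_units_def pairwise_def Linear_Algebra.orthogonal_def inner_complex_def zero_prod_def)
  then have "independent (set imag_units)"
    by (rule pairwise_orthogonal_independent)
  moreover have "card (set imag_units) = 7"
    by (simp add: imag_units_def)
  ultimately show ?thesis
    by (metis dim_span_eq_card_independent span_imag_units)
qed

section \<open>Eigenvalues of a real operator through its complexification\<close>

text \<open>
  The complexification of a real subspace \<open>V\<close> is \<open>V \<times> V\<close>, with \<open>(u, v)\<close> standing for
  \<open>u + \<i> v\<close>; an operator \<open>T\<close> on \<open>V\<close> extends to \<open>map_prod T T\<close>.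
\<close>

definition cscale :: "complex \<Rightarrow> 'a::real_vector \<times> 'a \<Rightarrow> 'a \<times> 'a" where
  "cscale c = (\<lambda>(u, v). (Re c *\<^sub>R u - Im c *\<^sub>R v, Im c *\<^sub>R u + Re c *\<^sub>R v))"

interpretation cplx: vector_space "cscale :: complex \<Rightarrow> 'a::real_vector \<times> 'a \<Rightarrow> 'a \<times> 'a"
  by standard (auto simp: cscale_def algebra_simps)

definition complex_eigenspace ::
    "'a::real_vector set \<Rightarrow> ('a \<Rightarrow> 'a) \<Rightarrow> complex \<Rightarrow> ('a \<times> 'a) set" where
  "complex_eigenspace V T c = {w \<in> V \<times> V. map_prod T T w = cscale c w}"

definition complex_eigenvalues :: "'a::real_vector set \<Rightarrow> ('a \<Rightarrow> 'a) \<Rightarrow> complex set" where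
  "complex_eigenvalues V T = {c. \<exists>w \<in> complex_eigenspace V T c. w \<noteq> 0}"

definition geom_mult :: "'a::real_vector set \<Rightarrow> ('a \<Rightarrow> 'a) \<Rightarrow> complex \<Rightarrow> nat" where
  "geom_mult V T c = cplx.dim (complex_eigenspace V T c)"

text \<open>
  Here \<open>bs\<close> is meant to be an orthonormal basis of \<open>V\<close>. It is at the same time a complex
  basis of the complexification of \<open>V\<close>, in which \<open>T\<close> and \<open>map_prod T T\<close> have the same matrix.
\<close>

definition complex_matrix :: "'a::real_inner list \<Rightarrow> ('a \<Rightarrow> 'a) \<Rightarrow> complex mat" where
  "complex_matrix bs T =
     mat (length bs) (length bs) (\<lambda>(i, j). complex_of_real (inner (T (bs ! j)) (bs ! i)))"

definition alg_mult :: "'a::real_inner list \<Rightarrow> ('a \<Rightarrow> 'a) \<Rightarrow> complex \<Rightarrow> nat" where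
  "alg_mult bs T c = Polynomial.order c (char_poly (complex_matrix bs T))"

end

theory Submission
  imports Defs
begin

text \<open>
  For imaginary \<open>x, y\<close> the bracket is the product with its real part removed,
  \<open>[x,y] = x y + \<langle>x,y\<rangle> 1\<close>. Since octonions are alternative and \<open>x x = - \<parallel>x\<parallel>\<^sup>2 1\<close>, this gives
  \<open>ad(x)\<^sup>2 y = \<langle>x,y\<rangle> x - \<parallel>x\<parallel>\<^sup>2 y\<close> (\<open>ad_ad_imag\<close>). The identity is used twice:
  applied to \<open>ad(x) y\<close>, which is orthogonal to \<open>x\<close>, it gives the cubic relation
  \<open>ad(x)\<^sup>3 = - \<parallel>x\<parallel>\<^sup>2 ad(x)\<close>, and applied to a \<open>y\<close> in the kernel it shows that the kernel is
  the line through \<open>x\<close>.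

  The cubic relation says that \<open>ad(x)\<close> is annihilated by \<open>t (t - \<mu>) (t + \<mu>)\<close> with
  \<open>\<mu> = \<i> \<parallel>x\<parallel>\<close>. The three roots are distinct, so the spectral projections, which are polynomials
  in the operator, split the complexification into the three eigenspaces
  (\<open>cubic_eigenspace_decomposition\<close>). Therefore algebraic and geometric multiplicities agree and
  the latter add up to 7 (\<open>multiplicities_of_decomposition\<close>). The eigenvalue 0 has multiplicity 1
  by the description of the kernel. Since \<open>ad(x)\<close> is real, complex conjugation exchanges the
  eigenspaces of \<open>\<mu>\<close> and \<open>-\<mu>\<close> (\<open>geom_mult_cnj_le\<close>), so each of these has multiplicity
  \<open>(7 - 1) / 2 = 3\<close>.
\<close>

section \<open>Coordinates in the complexification\<close>

text \<open>
  For \<open>w = u + \<i> v\<close> this is \<open>\<langle>u,b\<rangle> + \<i> \<langle>v,b\<rangle>\<close>, the complex-linear extension of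
  the coordinate function of a real vector \<open>b\<close>.
\<close>

definition cplx_coord :: "'a::real_inner \<times> 'a \<Rightarrow> 'a \<Rightarrow> complex" where
  "cplx_coord w b = Complex (inner (fst w) b) (inner (snd w) b)"

lemma cplx_coord_add: "cplx_coord (v + w) b = cplx_coord v b + cplx_coord w b"
  by (simp add: cplx_coord_def inner_add_left complex_eq_iff)

lemma cplx_coord_cscale: "cplx_coord (cscale c w) b = c * cplx_coord w b"
  by (simp add: cplx_coord_def cscale_def inner_add_left inner_diff_left complex_eq_iff
      split: prod.split)

lemma cplx_coord_zero: "cplx_coord 0 b = 0"
  by (simp add: cplx_coord_def complex_eq_iff)

lemma cplx_coord_sum: "cplx_coord (\<Sum>i\<in>I. f i) b = (\<Sum>i\<in>I. cplx_coord (f i) b)"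
  by (induction I rule: infinite_finite_induct) (simp_all add: cplx_coord_add cplx_coord_zero)

lemma cscale_map_prod:
  assumes "linear T"
  shows "map_prod T T (cscale c w) = cscale c (map_prod T T w)"
  by (cases w) (simp add: cscale_def linear_add linear_diff linear_scale assms)

lemma map_prod_add:
  assumes "linear T"
  shows "map_prod T T (v + w) = map_prod T T v + map_prod T T w"
  by (cases v; cases w) (simp add: linear_add assms)

lemma map_prod_sum:
  assumes "linear T"
  shows "map_prod T T (\<Sum>i\<in>I. f i) = (\<Sum>i\<in>I. map_prod T T (f i))"
  by (induction I rule: infinite_finite_induct)
     (simp_all add: map_prod_add assms linear_0 zero_prod_def)

locale orthonormal_list =
  fixes bs :: "'a::real_inner list"
  assumes orthonormal:
    "i < length bs \<Longrightarrow> j < length bs \<Longrightarrow> inner (bs ! i) (bs ! j) = (if i = j then 1 else 0)"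
begin

lemma expansion:
  assumes "v \<in> span (set bs)"
  shows "v = (\<Sum>i<length bs. inner v (bs ! i) *\<^sub>R bs ! i)"
  using assms
proof (induction rule: span_induct_alt)
  case base
  then show ?case by simp
next
  case (step c b v)
  then obtain j where j: "j < length bs" "b = bs ! j"
    by (metis in_set_conv_nth)
  have "(\<Sum>i<length bs. inner b (bs ! i) *\<^sub>R bs ! i)
      = (\<Sum>i<length bs. if i = j then bs ! j else 0)"
    using j by (intro sum.cong) (auto simp: orthonormal)
  also have "\<dots> = b"
    using j by simp
  finally have "(\<Sum>i<length bs. inner b (bs ! i) *\<^sub>R bs ! i) = b" .
  then have "(\<Sum>i<length bs. inner (c *\<^sub>R b + v) (bs ! i) *\<^sub>R bs ! i) = c *\<^sub>R b + v"
    using step(2)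
    by (simp add: inner_add_left scaleR_add_left sum.distrib flip: scaleR_scaleR scaleR_sum_right)
  then show ?case by simp
qed

lemma cplx_expansion:
  assumes "w \<in> span (set bs) \<times> span (set bs)"
  shows "w = (\<Sum>i<length bs. cscale (cplx_coord w (bs ! i)) (bs ! i, 0))"
proof -
  have "(\<Sum>i<length bs. cscale (cplx_coord w (bs ! i)) (bs ! i, 0))
      = ((\<Sum>i<length bs. inner (fst w) (bs ! i) *\<^sub>R bs ! i),
         (\<Sum>i<length bs. inner (snd w) (bs ! i) *\<^sub>R bs ! i))"
    by (simp add: cscale_def cplx_coord_def sum_prod)
  also have "\<dots> = w"
    using assms expansion[of "fst w"] expansion[of "snd w"] by (cases w) simp
  finally show ?thesis by simp
qed

text \<open>
  With \<open>b\<close> ranging over \<open>bs\<close>, this says that \<open>complex_matrix bs T\<close> takes the coordinates of a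
  vector to those of its image.
\<close>

lemma cplx_coord_map_prod:
  assumes "linear T" "w \<in> span (set bs) \<times> span (set bs)"
  shows "cplx_coord (map_prod T T w) b
    = (\<Sum>j<length bs. of_real (inner (T (bs ! j)) b) * cplx_coord w (bs ! j))"
proof -
  have "map_prod T T w = (\<Sum>j<length bs. cscale (cplx_coord w (bs ! j)) (T (bs ! j), 0))"
    using assms
    by (subst cplx_expansion[OF assms(2)])
       (simp add: map_prod_sum cscale_map_prod linear_0)
  moreover have "cplx_coord (T v, 0) b = of_real (inner (T v) b)" for v
    by (simp add: cplx_coord_def complex_eq_iff)
  ultimately show ?thesis
    by (simp add: cplx_coord_sum cplx_coord_cscale mult.commute)
qed

lemma cplx_coord_basis:
  assumes "i < length bs" "k < length bs"
  shows "cplx_coord (bs ! k, 0) (bs ! i) = (if i = k then 1 else 0)"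
  using assms by (simp add: cplx_coord_def orthonormal complex_eq_iff)

lemma cplx_span_basis: "span (set bs) \<times> span (set bs) \<subseteq> cplx.span ((\<lambda>b. (b, 0)) ` set bs)"
proof
  fix w assume "w \<in> span (set bs) \<times> span (set bs)"
  then have "w = (\<Sum>i<length bs. cscale (cplx_coord w (bs ! i)) (bs ! i, 0))"
    by (rule cplx_expansion)
  moreover have "\<dots> \<in> cplx.span ((\<lambda>b. (b, 0)) ` set bs)"
    by (intro cplx.span_sum cplx.span_scale cplx.span_base) auto
  ultimately show "w \<in> cplx.span ((\<lambda>b. (b, 0)) ` set bs)" by metis
qed

text \<open>
  Both \<open>B\<close> and the vectors \<open>(b, 0)\<close>, for \<open>b\<close> in the real basis, are complex bases of the same
  space, so the exchange lemma applies in both directions.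
\<close>

lemma card_cplx_basis:
  assumes ind: "cplx.independent B" and sub: "B \<subseteq> span (set bs) \<times> span (set bs)"
    and spn: "span (set bs) \<times> span (set bs) \<subseteq> cplx.span B"
  shows "finite B" "card B = length bs"
proof -
  define e where "e i = (bs ! i, 0 :: 'a)" for i
  let ?I = "{..<length bs}"
  have coord: "cplx_coord (e k) (bs ! i) = (if i = k then 1 else 0)" if "i \<in> ?I" "k \<in> ?I" for i k
    using that by (simp add: e_def cplx_coord_basis)
  have inj: "inj_on e ?I"
    by (rule inj_onI) (metis coord zero_neq_one)
  have "cplx.independent (e ` ?I)"
  proof (rule cplx.independent_if_scalars_zero)
    fix f v assume sum0: "(\<Sum>x\<in>e ` ?I. cscale (f x) x) = 0" and "v \<in> e ` ?I"
    then obtain i where i: "i \<in> ?I" "v = e i" by blast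
    have "0 = cplx_coord (\<Sum>k\<in>?I. cscale (f (e k)) (e k)) (bs ! i)"
      using sum0 by (simp add: sum.reindex[OF inj] cplx_coord_zero)
    also have "\<dots> = (\<Sum>k\<in>?I. if k = i then f (e i) else 0)"
      unfolding cplx_coord_sum cplx_coord_cscale
      using i coord by (intro sum.cong) auto
    also have "\<dots> = f v"
      using i by simp
    finally show "f v = 0" by simp
  qed simp
  moreover have "e ` ?I \<subseteq> cplx.span B"
    using spn by (auto simp: e_def span_base span_zero intro!: subsetD[OF spn])
  moreover have "B \<subseteq> cplx.span (e ` ?I)"
  proof -
    have "e ` ?I = (\<lambda>b. (b, 0)) ` set bs"
      by (auto simp: e_def set_conv_nth)
    then show ?thesis
      using sub cplx_span_basis by auto
  qed
  moreover have "card (e ` ?I) = length bs"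
    using inj by (simp add: card_image)
  ultimately show "finite B" "card B = length bs"
    using cplx.independent_span_bound[of "e ` ?I" B] cplx.independent_span_bound[of B "e ` ?I"]
      ind by (auto intro!: antisym)
qed

end

section \<open>Diagonalizable operators\<close>

lemma order_prod_linear:
  fixes f :: "'b \<Rightarrow> 'c::idom"
  assumes "finite B"
  shows "Polynomial.order c (\<Prod>b\<in>B. [:- f b, 1:]) = card {b \<in> B. f b = c}"
  using assms
proof (induction B)
  case empty
  then show ?case by (simp add: order_0I)
next
  case (insert b B)
  have "[:- f b, 1:] * (\<Prod>b\<in>B. [:- f b, 1:]) \<noteq> 0"
    using insert(1) by (simp add: prod_zero_iff del: mult_pCons_left)
  then have "Polynomial.order c (\<Prod>b\<in>insert b B. [:- f b, 1:])
      = Polynomial.order c [:- f b, 1:] + card {b \<in> B. f b = c}"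
    unfolding prod.insert[OF insert.hyps] using insert.IH by (simp only: order_mult not_False_eq_True)
  moreover have "Polynomial.order c [:- f b, 1:] = (if f b = c then 1 else 0)"
    using order_power_n_n[of c 1] by (auto intro!: order_0I)
  moreover have "{x \<in> insert b B. f x = c}
      = (if f b = c then insert b {x \<in> B. f x = c} else {x \<in> B. f x = c})"
    by auto
  ultimately show ?case
    using insert(1,2) by simp
qed

text \<open>
  Let \<open>P\<close> have the coordinates of the eigenvectors as columns and let \<open>D\<close> be the diagonal matrix
  of the eigenvalues. The eigenvalue equations say \<open>A P = P D\<close>. That \<open>B\<close> spans means that \<open>P\<close>
  has a right inverse, which for square matrices is an inverse; so \<open>A\<close> is similar to \<open>D\<close>.
\<close>

lemma (in orthonormal_list) char_poly_eigenbasis: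
  assumes "linear T"
    and fin: "finite B" and card: "card B = length bs"
    and sub: "B \<subseteq> span (set bs) \<times> span (set bs)"
    and spn: "span (set bs) \<times> span (set bs) \<subseteq> cplx.span B"
    and eig: "\<And>b. b \<in> B \<Longrightarrow> map_prod T T b = cscale (ev b) b"
  shows "char_poly (complex_matrix bs T) = (\<Prod>b\<in>B. [:- ev b, 1:])"
proof -
  define n where "n = length bs"
  obtain w where w: "bij_betw w {..<n} B"
    using ex_bij_betw_nat_finite[OF fin] card by (auto simp: n_def lessThan_atLeast0)
  then have wB: "w j \<in> B" if "j < n" for j
    using that by (auto simp: bij_betw_def)
  have "\<exists>u. (bs ! k, 0) = (\<Sum>b\<in>B. cscale (u b) b)" if "k < n" for k
  proof -
    have "(bs ! k, 0) \<in> cplx.span B"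
      using that by (intro subsetD[OF spn]) (simp add: n_def span_base span_zero)
    then show ?thesis
      unfolding cplx.span_finite[OF fin] by auto
  qed
  \<comment> \<open>The coefficients of the real basis vectors in terms of \<open>B\<close> form the inverse of
    the matrix \<open>P\<close> below.\<close>
  then obtain u where u: "\<And>k. k < n \<Longrightarrow> (bs ! k, 0) = (\<Sum>b\<in>B. cscale (u k b) b)"
    by metis
  let ?A = "complex_matrix bs T"
  define P where "P = Matrix.mat n n (\<lambda>(i, j). cplx_coord (w j) (bs ! i))"
  define Q where "Q = Matrix.mat n n (\<lambda>(j, k). u k (w j))"
  define D where "D = mat_diag n (\<lambda>j. ev (w j))"
  have carrier: "?A \<in> carrier_mat n n" "P \<in> carrier_mat n n" "Q \<in> carrier_mat n n"
    "D \<in> carrier_mat n n"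
    by (simp_all add: complex_matrix_def n_def P_def Q_def D_def)
  have "P * Q = 1\<^sub>m n"
  proof (rule eq_matI)
    fix i k assume "i < dim_row (1\<^sub>m n)" "k < dim_col (1\<^sub>m n)"
    then have ik: "i < n" "k < n" by auto
    have "(P * Q) $$ (i, k) = (\<Sum>j<n. u k (w j) * cplx_coord (w j) (bs ! i))"
      using ik by (simp add: P_def Q_def scalar_prod_def lessThan_atLeast0 mult.commute)
    also have "\<dots> = (\<Sum>b\<in>B. u k b * cplx_coord b (bs ! i))"
      by (rule sum.reindex_bij_betw[OF w])
    also have "\<dots> = cplx_coord (bs ! k, 0) (bs ! i)"
      by (simp add: u[OF ik(2)] cplx_coord_sum cplx_coord_cscale)
    finally show "(P * Q) $$ (i, k) = 1\<^sub>m n $$ (i, k)"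
      using ik by (simp add: cplx_coord_basis n_def)
  qed (simp_all add: P_def Q_def)
  moreover from this have "Q * P = 1\<^sub>m n"
    by (rule mat_mult_left_right_inverse[OF carrier(2,3)])
  moreover have "?A = P * D * Q"
  proof -
    have AP: "?A * P = P * D"
    proof (rule eq_matI)
      fix i j assume "i < dim_row (P * D)" "j < dim_col (P * D)"
      then have ij: "i < n" "j < n" using carrier by auto
      have "(?A * P) $$ (i, j)
          = (\<Sum>k<n. of_real (inner (T (bs ! k)) (bs ! i)) * cplx_coord (w j) (bs ! k))"
        using ij by (simp add: complex_matrix_def P_def scalar_prod_def lessThan_atLeast0 n_def)
      also have "\<dots> = cplx_coord (map_prod T T (w j)) (bs ! i)"
        using sub wB[OF ij(2)] \<open>linear T\<close> unfolding n_def by (subst cplx_coord_map_prod) auto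
      also have "\<dots> = (P * D) $$ (i, j)"
        using ij unfolding D_def mat_diag_mult_right[OF carrier(2)]
        by (simp add: eig wB cplx_coord_cscale P_def mult.commute)
      finally show "(?A * P) $$ (i, j) = (P * D) $$ (i, j)" .
    qed (use carrier in auto)
    have "P * D * Q = ?A * (P * Q)"
      using carrier by (simp flip: AP)
    then show ?thesis
      using carrier \<open>P * Q = 1\<^sub>m n\<close> by simp
  qed
  ultimately have "similar_mat ?A D"
    unfolding similar_mat_def using carrier by (blast intro: similar_mat_witI)
  then have "char_poly ?A = char_poly D"
    by (rule char_poly_similar)
  also have "\<dots> = (\<Prod>a\<leftarrow>diag_mat D. [:- a, 1:])"
    by (rule char_poly_upper_triangular[OF carrier(4)])
       (auto simp: D_def mat_diag_def upper_triangular_def)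
  also have "diag_mat D = map (\<lambda>j. ev (w j)) [0..<n]"
    by (auto simp: diag_mat_def D_def mat_diag_def)
  also have "(\<Prod>a\<leftarrow>\<dots>. [:- a, 1:]) = (\<Prod>j<n. [:- ev (w j), 1:])"
    by (simp add: prod.list_conv_set_nth lessThan_atLeast0)
  also have "\<dots> = (\<Prod>b\<in>B. [:- ev b, 1:])"
    by (rule prod.reindex_bij_betw[OF w])
  finally show ?thesis .
qed

lemma complex_eigenspaceD:
  "w \<in> complex_eigenspace V T c \<Longrightarrow> map_prod T T w = cscale c w"
  "w \<in> complex_eigenspace V T c \<Longrightarrow> w \<in> V \<times> V"
  by (simp_all add: complex_eigenspace_def)

lemma cplx_subspace_Times:
  assumes "subspace V"
  shows "cplx.subspace (V \<times> V)"
  using assms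
  by (intro cplx.subspaceI)
     (auto simp: cscale_def zero_prod_def subspace_0 subspace_add subspace_diff subspace_scale)

lemma subspace_complex_eigenspace:
  assumes "subspace V" "linear T"
  shows "cplx.subspace (complex_eigenspace V T c)"
proof (rule cplx.subspaceI)
  show "0 \<in> complex_eigenspace V T c"
    using assms by (simp add: complex_eigenspace_def zero_prod_def subspace_0 linear_0 cscale_def)
next
  fix v w assume "v \<in> complex_eigenspace V T c" "w \<in> complex_eigenspace V T c"
  then show "v + w \<in> complex_eigenspace V T c"
    using assms by (auto simp: complex_eigenspace_def map_prod_add cplx.scale_right_distrib
        subspace_add simp del: map_prod_simp)
next
  fix d w assume "w \<in> complex_eigenspace V T c"
  then show "cscale d w \<in> complex_eigenspace V T c"
    using assms(2) cplx.subspace_scale[OF cplx_subspace_Times[OF assms(1)], of w d]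
    by (simp add: complex_eigenspace_def cscale_map_prod mult.commute)
qed

text \<open>
  Applying \<open>T - d\<close> to a vanishing sum of eigenvectors removes the term for \<open>d\<close> and multiplies
  the one for \<open>c\<close> by \<open>c - d\<close>, which is nonzero; this reduces the claim to one eigenvalue less.
\<close>

lemma complex_eigenspaces_independent:
  assumes "subspace V" "linear T" "finite C"
    and "\<And>c. c \<in> C \<Longrightarrow> w c \<in> complex_eigenspace V T c"
    and "(\<Sum>c\<in>C. w c) = 0" "c \<in> C"
  shows "w c = 0"
  using assms(3-)
proof (induction C arbitrary: w c rule: finite_induct)
  case empty
  then show ?case by simp
next
  case (insert d C)
  have "(\<Sum>c\<in>insert d C. cscale (c - d) (w c))
      = (\<Sum>c\<in>insert d C. map_prod T T (w c) - cscale d (w c))"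
    using complex_eigenspaceD(1)[OF insert.prems(1)]
    by (intro sum.cong) (simp_all add: cplx.scale_left_diff_distrib)
  also have "\<dots> = (\<Sum>c\<in>insert d C. map_prod T T (w c)) - cscale d (\<Sum>c\<in>insert d C. w c)"
    by (simp only: sum_subtractf cplx.scale_sum_right)
  also have "\<dots> = map_prod T T 0"
    by (simp only: map_prod_sum[OF assms(2), symmetric] insert.prems(2) cplx.scale_zero_right diff_zero)
  also have "\<dots> = 0"
    using assms(2) by (simp add: linear_0 zero_prod_def)
  finally have "(\<Sum>c\<in>C. cscale (c - d) (w c)) = 0"
    using insert.hyps by simp
  moreover have "cscale (c - d) (w c) \<in> complex_eigenspace V T c" if "c \<in> C" for c
    using subspace_complex_eigenspace[OF assms(1,2)] insert.prems(1) that
    by (simp add: cplx.subspace_scale)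
  ultimately have "cscale (c - d) (w c) = 0" if "c \<in> C" for c
    using insert.IH[of "\<lambda>c. cscale (c - d) (w c)"] that by blast
  then have "w c = 0" if "c \<in> C" for c
    using that insert.hyps by fastforce
  then show ?case
    using insert.prems(2,3) insert.hyps by auto
qed

lemma complex_eigenvalues_subset:
  assumes V: "subspace V" "linear T" "finite C"
    and spn: "\<And>w. w \<in> V \<times> V \<Longrightarrow> \<exists>p. (\<forall>c\<in>C. p c \<in> complex_eigenspace V T c) \<and> w = (\<Sum>c\<in>C. p c)"
  shows "complex_eigenvalues V T \<subseteq> C"
proof
  fix d assume "d \<in> complex_eigenvalues V T"
  then obtain w where w: "w \<in> complex_eigenspace V T d" "w \<noteq> 0"
    by (auto simp: complex_eigenvalues_def)
  show "d \<in> C"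
  proof (rule ccontr)
    assume d: "d \<notin> C"
    obtain p where p: "\<forall>c\<in>C. p c \<in> complex_eigenspace V T c" "w = (\<Sum>c\<in>C. p c)"
      using spn[OF complex_eigenspaceD(2)[OF w(1)]] by blast
    \<comment> \<open>Written as \<open>- w + (\<Sum>c\<in>C. p c) = 0\<close>, the decomposition contradicts the
      independence of the eigenspaces for \<open>insert d C\<close>.\<close>
    let ?q = "p(d := - w)"
    have "- w \<in> complex_eigenspace V T d"
      using w(1) subspace_complex_eigenspace[OF V(1,2)] by (simp add: cplx.subspace_neg)
    moreover have sum_q: "(\<Sum>c\<in>C. ?q c) = w"
      using d unfolding p(2) by (intro sum.cong) auto
    ultimately have "?q c \<in> complex_eigenspace V T c" if "c \<in> insert d C" for c
      using p(1) that by auto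
    moreover have "(\<Sum>c\<in>insert d C. ?q c) = 0"
      using sum_q d V(3) by simp
    ultimately have "?q d = 0"
      using complex_eigenspaces_independent[OF V(1,2), of "insert d C" ?q d] V(3) by blast
    then show False
      using w(2) by simp
  qed
qed

text \<open>
  Bases of the eigenspaces combine to a basis of the whole complexification, since eigenspaces for
  different eigenvalues are independent. Counting this basis gives the sum of the geometric
  multiplicities, and the characteristic polynomial read off from it gives the algebraic ones.
\<close>

lemma (in orthonormal_list) multiplicities_of_decomposition:
  fixes T :: "'a \<Rightarrow> 'a"
  defines "V \<equiv> span (set bs)"
  assumes lin: "linear T" and C: "finite C"
    and decomp: "\<And>w. w \<in> V \<times> V \<Longrightarrow> \<exists>p. (\<forall>c\<in>C. p c \<in> complex_eigenspace V T c) \<and> w = (\<Sum>c\<in>C. p c)"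
  shows "(\<Sum>c\<in>C. geom_mult V T c) = length bs"
    and "\<And>c. c \<in> C \<Longrightarrow> alg_mult bs T c = geom_mult V T c"
proof -
  let ?E = "complex_eigenspace V T"
  have V: "subspace V" unfolding V_def by simp
  have "\<exists>B. B \<subseteq> ?E c \<and> cplx.independent B \<and> ?E c \<subseteq> cplx.span B \<and> card B = geom_mult V T c" for c
    unfolding geom_mult_def by (rule cplx.basis_exists) blast
  then obtain B where B: "\<And>c. B c \<subseteq> ?E c" "\<And>c. cplx.independent (B c)"
    "\<And>c. ?E c \<subseteq> cplx.span (B c)" "\<And>c. card (B c) = geom_mult V T c"
    by metis
  have spanB: "cplx.span (B c) \<subseteq> ?E c" for c
    by (rule cplx.span_minimal[OF B(1) subspace_complex_eigenspace[OF V lin]])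
  have disj: "c = d" if "c \<in> C" "d \<in> C" "b \<in> B c" "b \<in> B d" for b c d
  proof -
    have "cscale c b = cscale d b"
      using that B(1) complex_eigenspaceD(1) by (metis subsetD)
    moreover have "b \<noteq> 0"
      using that B(2) cplx.dependent_zero by metis
    ultimately show ?thesis by simp
  qed
  have fin: "finite (B c)" for c
  proof -
    have "B c \<subseteq> cplx.span ((\<lambda>b. (b, 0)) ` set bs)"
      using B(1) complex_eigenspaceD(2) cplx_span_basis unfolding V_def by blast
    then show ?thesis
      using cplx.independent_span_bound[OF _ B(2)] by blast
  qed
  let ?U = "\<Union>c\<in>C. B c"
  have split: "(\<Sum>b\<in>?U. g b) = (\<Sum>c\<in>C. \<Sum>b\<in>B c. g b)" for g :: "'a \<times> 'a \<Rightarrow> 'a \<times> 'a"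
    using disj fin C by (intro sum.UNION_disjoint) auto
  have ind: "cplx.independent ?U"
  proof (rule cplx.independent_if_scalars_zero)
    fix f b assume sum0: "(\<Sum>b\<in>?U. cscale (f b) b) = 0" and "b \<in> ?U"
    then obtain c where c: "c \<in> C" "b \<in> B c" by blast
    have "(\<Sum>b\<in>B c. cscale (f b) b) = 0"
    proof (rule complex_eigenspaces_independent[OF V lin C])
      show "(\<Sum>b\<in>B d. cscale (f b) b) \<in> ?E d" for d
        by (intro subsetD[OF spanB] cplx.span_sum cplx.span_scale cplx.span_base)
      show "(\<Sum>d\<in>C. \<Sum>b\<in>B d. cscale (f b) b) = 0"
        using sum0 by (simp only: split)
    qed (rule c(1))
    then show "f b = 0"
      using cplx.independentD[OF B(2) fin order.refl] c(2) by blast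
  qed (use C fin in auto)
  have sub: "?U \<subseteq> V \<times> V"
    using B(1) complex_eigenspaceD(2) by blast
  have spn: "V \<times> V \<subseteq> cplx.span ?U"
  proof
    fix w assume "w \<in> V \<times> V"
    then obtain p where p: "\<forall>c\<in>C. p c \<in> ?E c" "w = (\<Sum>c\<in>C. p c)"
      using decomp by blast
    have "p c \<in> cplx.span ?U" if "c \<in> C" for c
      using that p(1) B(3) cplx.span_mono[of "B c" ?U] by blast
    then show "w \<in> cplx.span ?U"
      unfolding p(2) by (rule cplx.span_sum)
  qed
  have card: "card ?U = length bs"
    using card_cplx_basis(2)[OF ind] sub spn unfolding V_def by blast
  then show "(\<Sum>c\<in>C. geom_mult V T c) = length bs"
    using disj fin C by (subst (asm) card_UN_disjoint) (auto simp: B(4))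
  obtain ev where ev: "\<And>c b. c \<in> C \<Longrightarrow> b \<in> B c \<Longrightarrow> ev b = c"
  proof
    show "(THE d. d \<in> C \<and> b \<in> B d) = c" if "c \<in> C" "b \<in> B c" for c b
      using that disj by blast
  qed
  have poly: "char_poly (complex_matrix bs T) = (\<Prod>b\<in>?U. [:- ev b, 1:])"
  proof (rule char_poly_eigenbasis[OF lin _ card])
    show "map_prod T T b = cscale (ev b) b" if "b \<in> ?U" for b
      using that ev B(1) complex_eigenspaceD(1) by (metis UN_E subsetD)
  qed (use sub spn C fin in \<open>auto simp: V_def\<close>)
  show "alg_mult bs T c = geom_mult V T c" if "c \<in> C" for c
  proof -
    have "{b \<in> ?U. ev b = c} = B c"
      using ev that by blast
    then show ?thesis
      using C fin by (simp add: alg_mult_def poly order_prod_linear B(4))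
  qed
qed

section \<open>Real operators: conjugate eigenvalues and cubic relations\<close>

text \<open>
  The conjugation \<open>u + \<i> v \<mapsto> u - \<i> v\<close> commutes with the complexification of a real operator, so
  it maps the eigenspace of \<open>cnj c\<close> to that of \<open>c\<close>. It is only conjugate-linear, but it still
  maps spanning sets to spanning sets, which suffices to compare dimensions. Equality follows by
  applying the inequality to \<open>cnj c\<close> as well; the finite set \<open>S\<close> makes the
  dimensions finite, as a comparison of cardinalities of bases requires.
\<close>

lemma geom_mult_cnj_le:
  assumes "subspace V" "linear T"
    and fin: "finite S" "V \<times> V \<subseteq> cplx.span S"
  shows "geom_mult V T (cnj c) \<le> geom_mult V T c"
proof -
  define \<sigma> where "\<sigma> = (\<lambda>(u, v). (u :: 'a, - v :: 'a))"
  let ?E = "complex_eigenspace V T"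
  obtain B where B: "B \<subseteq> ?E c" "cplx.independent B" "?E c \<subseteq> cplx.span B" "card B = cplx.dim (?E c)"
    by (rule cplx.basis_exists)
  have "finite B"
    using cplx.independent_span_bound[OF fin(1) B(2)] B(1) fin(2) complex_eigenspaceD(2) by blast
  have "\<sigma> w \<in> cplx.span (\<sigma> ` B)" if "w \<in> cplx.span B" for w
    using that
  proof (induction rule: cplx.span_induct_alt)
    case base
    have "\<sigma> 0 = 0" by (simp add: \<sigma>_def zero_prod_def)
    then show ?case by (simp add: cplx.span_zero)
  next
    case (step d b w)
    have "\<sigma> (cscale d b + w) = cscale (cnj d) (\<sigma> b) + \<sigma> w"
      by (cases b; cases w) (simp add: \<sigma>_def cscale_def)
    then show ?case
      using step by (simp add: cplx.span_add cplx.span_scale cplx.span_base)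
  qed
  moreover have "\<sigma> w \<in> ?E c" if "w \<in> ?E (cnj c)" for w
    using that assms(1,2)
    by (cases w) (auto simp: complex_eigenspace_def \<sigma>_def cscale_def subspace_neg linear_neg)
  moreover have "\<sigma> (\<sigma> w) = w" for w
    by (cases w) (simp add: \<sigma>_def)
  ultimately have "?E (cnj c) \<subseteq> cplx.span (\<sigma> ` B)"
    using B(3) by (metis subsetD subsetI)
  then have "cplx.dim (?E (cnj c)) \<le> card (\<sigma> ` B)"
    using \<open>finite B\<close> by (intro cplx.dim_le_card) auto
  also have "\<dots> \<le> cplx.dim (?E c)"
    using card_image_le[OF \<open>finite B\<close>] B(4) by metis
  finally show ?thesis
    by (simp add: geom_mult_def)
qed

lemma eigenvalue_if_geom_mult_pos:
  assumes "0 < geom_mult V T c"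
  shows "c \<in> complex_eigenvalues V T"
proof -
  obtain B where B: "B \<subseteq> complex_eigenspace V T c" "cplx.independent B" "card B = geom_mult V T c"
    unfolding geom_mult_def by (rule cplx.basis_exists)
  then obtain b where "b \<in> B"
    using assms by (metis card.empty equals0I less_irrefl)
  then have "b \<in> complex_eigenspace V T c" "b \<noteq> 0"
    using B(1,2) cplx.dependent_zero by auto
  then show ?thesis
    unfolding complex_eigenvalues_def by blast
qed

text \<open>
  The components are \<open>p 0 = (1 - S\<^sup>2 / c\<^sup>2) w\<close> and \<open>p d = (S\<^sup>2 + d S) w / (2 c\<^sup>2)\<close> for
  \<open>d = \<plusminus>c\<close>, where \<open>S\<close> is the complexified operator: these are the Lagrange interpolation
  polynomials at the nodes \<open>0, c, - c\<close>, evaluated at \<open>S\<close>.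
\<close>

lemma cubic_eigenspace_decomposition:
  fixes c :: complex and V :: "'a::real_vector set"
  defines "C \<equiv> {0, c, - c}"
  assumes V: "subspace V" and lin: "linear T" and inv: "\<And>v. v \<in> V \<Longrightarrow> T v \<in> V"
    and cubic: "\<And>w. w \<in> V \<times> V \<Longrightarrow>
      map_prod T T (map_prod T T (map_prod T T w)) = cscale (c\<^sup>2) (map_prod T T w)"
    and c: "c \<noteq> 0" and w: "w \<in> V \<times> V"
  shows "\<exists>p. (\<forall>d\<in>C. p d \<in> complex_eigenspace V T d) \<and> w = (\<Sum>d\<in>C. p d)"
proof -
  let ?S = "map_prod T T"
  \<comment> \<open>Apart from its sign, the leading coefficient of all three interpolation polynomials is \<open>k\<close>
    or \<open>2 * k\<close>.\<close>
  define k where "k = 1 / (2 * c\<^sup>2)"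
  define p where "p d = (if d = 0 then w + cscale (- (2 * k)) (?S (?S w))
    else cscale k (?S (?S w) + cscale d (?S w)))" for d
  have k: "2 * k * c\<^sup>2 = 1"
    using c by (simp add: k_def)
  note VV = cplx_subspace_Times[OF V]
  have S: "?S v \<in> V \<times> V" if "v \<in> V \<times> V" for v
    using that inv by auto
  have mem: "p d \<in> V \<times> V" for d
  proof -
    have "?S w \<in> V \<times> V" "?S (?S w) \<in> V \<times> V"
      by (intro S w)+
    then show ?thesis
      unfolding p_def
      using cplx.subspace_add[OF VV] cplx.subspace_scale[OF VV] w by presburger
  qed
  have "?S (p d) = cscale d (p d)" if "d \<in> C" for d
  proof (cases "d = 0")
    case True
    have "?S (p d) = ?S w + cscale (- (2 * k * c\<^sup>2)) (?S w)"
      using True by (simp add: p_def map_prod_add[OF lin] cscale_map_prod[OF lin] cubic[OF w]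
          del: add_uminus_conv_diff cplx.scale_minus_left)
    then show ?thesis
      using True by (simp add: k)
  next
    case False
    then have "d\<^sup>2 = c\<^sup>2"
      using that by (auto simp: C_def)
    then have "k * c\<^sup>2 = d * (k * d)"
      by (metis mult.left_commute power2_eq_square)
    then show ?thesis
      using False
      by (simp add: p_def map_prod_add[OF lin] cscale_map_prod[OF lin] cubic[OF w]
          cplx.scale_right_distrib mult.commute[of k d])
  qed
  moreover have "w = (\<Sum>d\<in>C. p d)"
  proof -
    have "c \<noteq> - c"
      using c by (simp add: eq_neg_iff_add_eq_0)
    then have "(\<Sum>d\<in>C. p d) = p 0 + p c + p (- c)"
      using c by (simp add: C_def add.assoc)
    moreover have "p c + p (- c) = cscale (2 * k) (?S (?S w))"
    proof -
      have "p c + p (- c) = cscale k (?S (?S w)) + cscale k (?S (?S w))"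
        using c by (simp add: p_def cplx.scale_right_distrib cplx.scale_right_diff_distrib)
      then show ?thesis
        by (simp flip: cplx.scale_left_distrib)
    qed
    ultimately show ?thesis
      by (simp add: p_def add.assoc)
  qed
  ultimately show ?thesis
    using mem unfolding complex_eigenspace_def by blast
qed

section \<open>The adjoint operator of an imaginary octonion\<close>

lemma linear_ad: "linear (ad x)"
  by (rule linearI)
     (simp_all add: ad_def obracket_def omult_bilinear_simps algebra_simps)

text \<open>
  Interchanging two imaginary octonions conjugates their product, so \<open>ad x y\<close> is the imaginary
  part of \<open>x \<star> y\<close>, whose real part is \<open>- inner x y\<close>.
\<close>

lemma ad_imag:
  assumes "x \<in> Im_oct" "y \<in> Im_oct"
  shows "ad x y = x \<star> y + inner x y *\<^sub>R oone"
  using assms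
  by (cases x rule: octonion_exhaust; cases y rule: octonion_exhaust)
     (simp add: ad_def obracket_def Im_oct_def oRe_def oone_def inner_complex_def complex_eq_iff
       algebra_simps)

lemma ad_in_Im_oct: "ad x y \<in> Im_oct"
  by (simp add: ad_def obracket_in_Im_oct)

lemma inner_ad: "inner x (ad x y) = 0"
  by (cases x rule: octonion_exhaust; cases y rule: octonion_exhaust)
     (simp add: ad_def obracket_def inner_complex_def algebra_simps)

text \<open>
  By orthogonality of \<open>x\<close> and \<open>ad x y\<close> the outer bracket is a plain product, and left
  alternativity turns \<open>x \<star> (x \<star> y)\<close> into \<open>(x \<star> x) \<star> y\<close>, a real multiple of \<open>y\<close>.
\<close>

lemma ad_ad_imag:
  assumes "x \<in> Im_oct" "y \<in> Im_oct"
  shows "ad x (ad x y) = inner x y *\<^sub>R x - (norm x)\<^sup>2 *\<^sub>R y"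
proof -
  have "x \<star> x = - (norm x)\<^sup>2 *\<^sub>R oone"
    using ad_imag[OF assms(1,1)] by (simp add: ad_def obracket_def power2_norm_eq_inner eq_neg_iff_add_eq_0)
  then have "x \<star> (x \<star> y) = - (norm x)\<^sup>2 *\<^sub>R y"
    by (simp add: omult_alternative(1) omult_bilinear_simps flip: scaleR_minus_left)
  moreover have "ad x (ad x y) = x \<star> ad x y"
    using ad_imag[OF assms(1) ad_in_Im_oct] by (simp add: inner_ad)
  ultimately show ?thesis
    by (simp add: ad_imag[OF assms] omult_bilinear_simps)
qed

lemma ad_cubed:
  assumes "x \<in> Im_oct"
  shows "ad x (ad x (ad x y)) = - ((norm x)\<^sup>2 *\<^sub>R ad x y)"
  by (simp add: ad_ad_imag[OF assms ad_in_Im_oct] inner_ad)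

lemma kernel_ad:
  assumes "x \<in> Im_oct" "y \<in> Im_oct" "x \<noteq> 0" "ad x y = 0"
  shows "y = (inner x y / (norm x)\<^sup>2) *\<^sub>R x"
proof -
  have "(norm x)\<^sup>2 *\<^sub>R y = inner x y *\<^sub>R x"
    using ad_ad_imag[OF assms(1,2)] assms(4) by (simp add: linear_0[OF linear_ad])
  then have "(1 / (norm x)\<^sup>2) *\<^sub>R ((norm x)\<^sup>2 *\<^sub>R y) = (1 / (norm x)\<^sup>2) *\<^sub>R (inner x y *\<^sub>R x)"
    by simp
  then show ?thesis
    using assms(3) by simp
qed

lemma geom_mult_ad_0:
  assumes "x \<in> Im_oct" "x \<noteq> 0"
  shows "geom_mult Im_oct (ad x) 0 = 1"
  unfolding geom_mult_def
proof (rule cplx.dim_unique)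
  let ?E = "complex_eigenspace Im_oct (ad x) 0"
  have "ad x x = 0" "ad x 0 = 0"
    by (simp_all add: ad_def obracket_def linear_0[OF linear_ad, unfolded ad_def obracket_def])
  then show "{(x, 0)} \<subseteq> ?E"
    using assms(1) subspace_0[OF subspace_Im_oct]
    by (simp add: complex_eigenspace_def flip: zero_prod_def)
  show "?E \<subseteq> cplx.span {(x, 0)}"
  proof
    fix w assume "w \<in> ?E"
    then obtain u v where w: "w = (u, v)" "u \<in> Im_oct" "v \<in> Im_oct" "ad x u = 0" "ad x v = 0"
      by (cases w) (auto simp: complex_eigenspace_def cscale_def zero_prod_def)
    have "w = cscale (Complex (inner x u / (norm x)\<^sup>2) (inner x v / (norm x)\<^sup>2)) (x, 0)"
      using kernel_ad[OF assms(1) _ assms(2)] w by (simp add: cscale_def)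
    then show "w \<in> cplx.span {(x, 0)}"
      by (simp add: cplx.span_scale cplx.span_base)
  qed
qed (use assms(2) in \<open>auto simp: zero_prod_def\<close>)

theorem proposition6p2:
  fixes x :: octonion
  assumes "x \<in> Im_oct" and "x \<noteq> 0"
  shows "complex_eigenvalues Im_oct (ad x) = {0, \<i> * of_real (norm x), - \<i> * of_real (norm x)}
    \<and> alg_mult imag_units (ad x) 0 = 1
    \<and> alg_mult imag_units (ad x) (\<i> * of_real (norm x)) = 3
    \<and> alg_mult imag_units (ad x) (- \<i> * of_real (norm x)) = 3
    \<and> geom_mult Im_oct (ad x) 0 = 1
    \<and> geom_mult Im_oct (ad x) (\<i> * of_real (norm x)) = 3
    \<and> geom_mult Im_oct (ad x) (- \<i> * of_real (norm x)) = 3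
    \<and> (\<forall>y \<in> Im_oct. (ad x ^^ 3) y = - ((norm x)\<^sup>2 *\<^sub>R ad x y))"
proof -
  interpret orthonormal_list imag_units
    by unfold_locales (simp add: length_imag_units imag_units_orthonormal)
  let ?\<mu> = "\<i> * of_real (norm x) :: complex"
  let ?C = "{0, ?\<mu>, - ?\<mu>}"
  let ?m = "geom_mult Im_oct (ad x)"
  have distinct: "?\<mu> \<noteq> 0" "- ?\<mu> \<noteq> 0" "?\<mu> \<noteq> - ?\<mu>"
    using assms(2) by (simp_all add: complex_eq_iff)
  have decomp: "\<exists>p. (\<forall>c\<in>?C. p c \<in> complex_eigenspace Im_oct (ad x) c) \<and> w = (\<Sum>c\<in>?C. p c)"
    if "w \<in> Im_oct \<times> Im_oct" for w
  proof (rule cubic_eigenspace_decomposition[OF subspace_Im_oct linear_ad ad_in_Im_oct])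
    show "map_prod (ad x) (ad x) (map_prod (ad x) (ad x) (map_prod (ad x) (ad x) v))
        = cscale (?\<mu>\<^sup>2) (map_prod (ad x) (ad x) v)" for v
      by (cases v) (simp add: ad_cubed[OF assms(1)] cscale_def power_mult_distrib flip: of_real_power)
  qed (use that distinct in simp_all)
  note multiplicities = multiplicities_of_decomposition[OF linear_ad, of "?C",
      unfolded span_imag_units, OF _ decomp]
  have zero: "?m 0 = 1"
    by (rule geom_mult_ad_0[OF assms])
  have "?m (cnj c) \<le> ?m c" for c
    by (rule geom_mult_cnj_le[OF subspace_Im_oct linear_ad _ cplx_span_basis[unfolded span_imag_units]]) simp
  \<comment> \<open>\<open>?\<mu>\<close> is purely imaginary, so its conjugate is \<open>- ?\<mu>\<close>.\<close>
  from this[of ?\<mu>] this[of "- ?\<mu>"] have "?m ?\<mu> = ?m (- ?\<mu>)"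
    by simp
  moreover have "?m 0 + ?m ?\<mu> + ?m (- ?\<mu>) = 7"
    using multiplicities(1) distinct by (simp add: length_imag_units)
  ultimately have three: "?m ?\<mu> = 3" "?m (- ?\<mu>) = 3"
    using zero by simp_all
  have "c \<in> complex_eigenvalues Im_oct (ad x)" if "c \<in> ?C" for c
    using that zero three by (intro eigenvalue_if_geom_mult_pos) auto
  moreover have "complex_eigenvalues Im_oct (ad x) \<subseteq> ?C"
    by (rule complex_eigenvalues_subset[OF subspace_Im_oct linear_ad _ decomp]) simp_all
  ultimately have "complex_eigenvalues Im_oct (ad x) = ?C"
    by blast
  moreover have "alg_mult imag_units (ad x) c = ?m c" if "c \<in> ?C" for c
    by (rule multiplicities(2)[OF _ _ that]) simp_all
  moreover have "(ad x ^^ 3) y = - ((norm x)\<^sup>2 *\<^sub>R ad x y)" for y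
    by (simp add: numeral_3_eq_3 ad_cubed[OF assms(1)])
  ultimately show ?thesis
    using zero three by auto
qed

end
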